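(* The permutation statistic $(a-cb)+(b-ca)+(c-ba)+[b-a)$ is Mahonian; that is, for every $n\ge1$ and every integer $k$, the number of $\pi\in\mathfrak S_n$ with $((a-cb)+(b-ca)+(c-ba)+[b-a))\,\pi=k$ equals the number of $\pi\in\mathfrak S_n$ with $\mathrm{inv}\,\pi=k$.
   Context: $\mathfrak S_n$ is the set of permutations $\pi=\pi_1\cdots\pi_n$ of $\{1,\dots,n\}$; $\mathrm{inv}\,\pi=\#\{(i,j):1\le i<j\le n,\ \pi_i>\pi_j\}$. Vincular patterns are words over letters $a<b<c$ possibly containing dashes and a leading "[" or trailing "]". An occurrence of a pattern $p=p_1\cdots p_k$ (letters, ignoring dashes and brackets) in $\pi$ is a sequence of positions $i_1<\dots<i_k$ such that $\pi_{i_1}\cdots\pi_{i_k}$ is order-isomorphic to $p_1\cdots p_k$, with $i_{r+1}=i_r+1$ whenever the $r$-th and $(r+1)$-st letters are not separated by a dash, $i_1=1$ if the pattern begins with "[", and $i_k=n$ if it ends with "]". $(\sigma+\tau+\cdots)\,\pi$ is the total number of occurrences of the listed patterns. E.g. $(b-ca)\,\pi=\#\{(i,j):i<j<n,\ \pi_{j+1}<\pi_i<\pi_j\}$ and $[b-a)\,\pi=\#\{j>1:\pi_j<\pi_1\}$. *)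

theory Defs
  imports "HOL-Combinatorics.Permutations"
begin

text \<open>
  Permutations of \<open>{1..n}\<close> are functions \<open>\<pi>\<close> with \<open>\<pi> permutes {1..n}\<close>; the word is
  \<open>\<pi> 1, \<dots>, \<pi> n\<close>, with positions counted from 1.
\<close>

definition inv_stat :: "nat \<Rightarrow> (nat \<Rightarrow> nat) \<Rightarrow> nat" where
  "inv_stat n \<pi> = card {(i, j). 1 \<le> i \<and> i < j \<and> j \<le> n \<and> \<pi> i > \<pi> j}"

text \<open>
  The letters \<open>a < b < c\<close> are encoded as \<open>1 < 2 < 3\<close>. The set \<open>dashes\<close> contains \<open>r\<close> iff
  there is a dash between the \<open>r\<close>-th and the \<open>(r+1)\<close>-st letter, counting letters from 1.
\<close>

record vincular =
  letters :: "nat list"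
  dashes :: "nat set"
  left_bracket :: bool
  right_bracket :: bool

definition occurrence :: "vincular \<Rightarrow> nat \<Rightarrow> (nat \<Rightarrow> nat) \<Rightarrow> nat list \<Rightarrow> bool" where
  "occurrence p n \<pi> xs \<longleftrightarrow>
     length xs = length (letters p) \<and>
     set xs \<subseteq> {1..n} \<and>
     sorted_wrt (<) xs \<and>
     (\<forall>r < length xs. \<forall>s < length xs.
        \<pi> (xs ! r) < \<pi> (xs ! s) \<longleftrightarrow> letters p ! r < letters p ! s) \<and>
     (\<forall>r. Suc r < length xs \<and> Suc r \<notin> dashes p \<longrightarrow> xs ! Suc r = xs ! r + 1) \<and>
     (left_bracket p \<longrightarrow> hd xs = 1) \<and>
     (right_bracket p \<longrightarrow> last xs = n)"

definition occurrences :: "vincular \<Rightarrow> nat \<Rightarrow> (nat \<Rightarrow> nat) \<Rightarrow> nat" where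
  "occurrences p n \<pi> = card {xs. occurrence p n \<pi> xs}"

text \<open>The patterns \<open>(a-cb)\<close>, \<open>(b-ca)\<close>, \<open>(c-ba)\<close> and \<open>[b-a)\<close>:\<close>

definition pat_a_cb :: vincular where
  "pat_a_cb = \<lparr>letters = [1, 3, 2], dashes = {1}, left_bracket = False, right_bracket = False\<rparr>"

definition pat_b_ca :: vincular where
  "pat_b_ca = \<lparr>letters = [2, 3, 1], dashes = {1}, left_bracket = False, right_bracket = False\<rparr>"

definition pat_c_ba :: vincular where
  "pat_c_ba = \<lparr>letters = [3, 2, 1], dashes = {1}, left_bracket = False, right_bracket = False\<rparr>"

definition pat_lb_a :: vincular where
  "pat_lb_a = \<lparr>letters = [2, 1], dashes = {1}, left_bracket = True, right_bracket = False\<rparr>"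

definition vinc_stat :: "nat \<Rightarrow> (nat \<Rightarrow> nat) \<Rightarrow> nat" where
  "vinc_stat n \<pi> = occurrences pat_a_cb n \<pi> + occurrences pat_b_ca n \<pi>
                  + occurrences pat_c_ba n \<pi> + occurrences pat_lb_a n \<pi>"

lemma occurrences_b_ca:
  "occurrences pat_b_ca n \<pi> =
     card {(i, j). 1 \<le> i \<and> i < j \<and> j < n \<and> \<pi> (j + 1) < \<pi> i \<and> \<pi> i < \<pi> j}"
proof -
  let ?S = "{(i, j). 1 \<le> i \<and> i < j \<and> j < n \<and> \<pi> (j + 1) < \<pi> i \<and> \<pi> i < \<pi> j}"
  have "{xs. occurrence pat_b_ca n \<pi> xs} = (\<lambda>(i, j). [i, j, j + 1]) ` ?S"
    by (auto simp: occurrence_def pat_b_ca_def length_Suc_conv less_Suc_eq image_iff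
        numeral_3_eq_3 all_conj_distrib disj_imp nth_Cons' split: if_splits)
  moreover have "inj_on (\<lambda>(i, j). [i, j, j + 1]) ?S"
    by (auto simp: inj_on_def)
  ultimately show ?thesis
    by (simp add: occurrences_def card_image)
qed

lemma occurrences_lb_a:
  "occurrences pat_lb_a n \<pi> = card {j. 1 < j \<and> j \<le> n \<and> \<pi> j < \<pi> 1}"
proof -
  let ?S = "{j. 1 < j \<and> j \<le> n \<and> \<pi> j < \<pi> 1}"
  have "{xs. occurrence pat_lb_a n \<pi> xs} = (\<lambda>j. [1, j]) ` ?S"
    by (auto simp: occurrence_def pat_lb_a_def length_Suc_conv less_Suc_eq image_iff
        numeral_2_eq_2 all_conj_distrib disj_imp nth_Cons' split: if_splits)
  moreover have "inj_on (\<lambda>j. [1, j]) ?S"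
    by (auto simp: inj_on_def)
  ultimately show ?thesis
    by (simp add: occurrences_def card_image)
qed

end

theory Submission
  imports Defs "HOL-Combinatorics.Multiset_Permutations"
begin

text \<open>
  The three patterns of length three together count, for every descent \<open>j\<close>, all \<open>j - 1\<close> positions
  before it, whatever their values. Hence the statistic is the first letter minus one plus the major
  index of the remaining word. Since \<open>inv\<close> is likewise the first letter minus one plus \<open>inv\<close> of the
  remaining word, the claim reduces to MacMahon's theorem that \<open>maj\<close> and \<open>inv\<close> are
  equidistributed. For this, take a word of length \<open>n\<close> on \<open>1, \<dots>, n\<close> with last letter \<open>m\<close>, and
  lift the letters smaller than \<open>m\<close> above all others. The descent at the front of each maximal block
  of lifted letters moves to the end of the block, so \<open>maj\<close> grows by \<open>m - 1\<close>. Now the last letter is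
  the smallest, and deleting it destroys a descent at \<open>n - 1\<close>. In total \<open>maj\<close> drops by \<open>n - m\<close>, just as
  \<open>inv\<close> does on deleting \<open>m\<close>.
\<close>

section \<open>Mahonian sums over permutations of a set\<close>

text \<open>The sum of \<open>g\<close> over the exponents of the expanded product
  \<open>(1 + q) (1 + q + q\<^sup>2) \<dots> (1 + \<dots> + q\<^bsup>n-1\<^esup>)\<close>.\<close>

fun mahonian_sum :: "nat \<Rightarrow> (nat \<Rightarrow> nat) \<Rightarrow> nat" where
  "mahonian_sum 0 g = g 0"
| "mahonian_sum (Suc n) g = (\<Sum>r<Suc n. mahonian_sum n (\<lambda>k. g (r + k)))"

lemma sum_permutations_of_set_Cons:
  fixes F :: "'a list \<Rightarrow> nat"
  assumes "finite A" "A \<noteq> {}"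
  shows "(\<Sum>xs\<in>permutations_of_set A. F xs) =
         (\<Sum>x\<in>A. \<Sum>ys\<in>permutations_of_set (A - {x}). F (x # ys))"
proof -
  have "(\<Sum>xs\<in>permutations_of_set A. F xs) =
        (\<Sum>x\<in>A. \<Sum>xs\<in>(#) x ` permutations_of_set (A - {x}). F xs)"
    unfolding permutations_of_set_nonempty[OF assms(2)]
    by (rule sum.UNION_disjoint) (use assms in auto)
  also have "\<dots> = (\<Sum>x\<in>A. \<Sum>ys\<in>permutations_of_set (A - {x}). F (x # ys))"
    by (rule sum.cong[OF refl], subst sum.reindex) auto
  finally show ?thesis .
qed

text \<open>Counting predecessors is strictly increasing along the strict linear order
  \<open>R\<close>, so the ranks are distinct, lie below \<open>card A\<close>, and hence exhaust
  \<open>{..<card A}\<close>.\<close>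

lemma sum_over_ranks:
  fixes h :: "nat \<Rightarrow> nat"
  assumes "finite A" "transp R" "irreflp R" "totalp R"
  shows "(\<Sum>x\<in>A. h (card {a\<in>A. R a x})) = (\<Sum>r<card A. h r)"
proof -
  let ?f = "\<lambda>x. card {a\<in>A. R a x}"
  have less: "?f x < ?f y" if "R x y" "x \<in> A" for x y
    by (rule psubset_card_mono)
       (use assms that in \<open>auto simp: irreflp_def dest: transpD\<close>)
  have inj: "inj_on ?f A"
  proof (rule inj_onI, rule ccontr)
    fix x y assume *: "x \<in> A" "y \<in> A" "?f x = ?f y" "x \<noteq> y"
    then have "R x y \<or> R y x" using totalpD[OF assms(4)] by blast
    then show False using * less[of x y] less[of y x] by auto
  qed
  have "?f x < card A" if "x \<in> A" for x
    by (rule psubset_card_mono) (use assms that in \<open>auto simp: irreflp_def\<close>)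
  then have "?f ` A = {..<card A}"
    by (intro card_subset_eq) (auto simp: card_image[OF inj])
  then show ?thesis
    using sum.reindex[OF inj, of h] by simp
qed

lemma length_filter_permutation:
  "ys \<in> permutations_of_set A \<Longrightarrow> length (filter P ys) = card {a\<in>A. P a}"
  by (metis distinct_card distinct_filter permutations_of_setD set_filter)

section \<open>Inversion number and major index of words\<close>

fun inv_list :: "nat list \<Rightarrow> nat" where
  "inv_list [] = 0"
| "inv_list (x # xs) = length (filter (\<lambda>y. y < x) xs) + inv_list xs"

text \<open>The major index of the reversed word; reversal makes deleting the last letter structural.\<close>

fun maj_rev :: "nat list \<Rightarrow> nat" where
  "maj_rev (x # y # ys) = (if x < y then Suc (length ys) else 0) + maj_rev (y # ys)"
| "maj_rev _ = 0"

text \<open>Word form of \<open>vinc_stat\<close>. Counting smaller letters replaces "first letter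
  minus one", which makes sense over any finite set of letters.\<close>

fun first_plus_maj :: "nat list \<Rightarrow> nat" where
  "first_plus_maj [] = 0"
| "first_plus_maj (x # xs) = length (filter (\<lambda>y. y < x) xs) + maj_rev (rev xs)"

text \<open>Common recursion step: the head contributes its rank, uniform on
  \<open>{..<card A}\<close>, and the tail has the same distribution for every head.
  \<open>S\<close> may depend on the head because the major index relabels the tail;
  \<open>R\<close> is \<open><\<close> for inversions and \<open>>\<close> for the major
  index.\<close>

lemma sum_Cons_mahonian:
  fixes g :: "nat \<Rightarrow> nat"
  assumes A: "finite A" "A \<noteq> {}" and R: "transp R" "irreflp R" "totalp R"
    and tail: "\<And>x g. x \<in> A \<Longrightarrow>
      (\<Sum>ys\<in>permutations_of_set (A - {x}). g (S x ys)) = mahonian_sum (card A - 1) g"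
    and head: "\<And>x ys. x \<in> A \<Longrightarrow> ys \<in> permutations_of_set (A - {x}) \<Longrightarrow>
      F (x # ys) = length (filter (\<lambda>y. R y x) ys) + S x ys"
  shows "(\<Sum>xs\<in>permutations_of_set A. g (F xs)) = mahonian_sum (card A) g"
proof -
  have cnt: "length (filter (\<lambda>y. R y x) ys) = card {a\<in>A. R a x}"
    if "ys \<in> permutations_of_set (A - {x})" for x ys
  proof -
    have "{a \<in> A - {x}. R a x} = {a\<in>A. R a x}"
      using R(2) by (auto simp: irreflp_def)
    then show ?thesis by (simp add: length_filter_permutation[OF that])
  qed
  have "(\<Sum>xs\<in>permutations_of_set A. g (F xs)) =
        (\<Sum>x\<in>A. \<Sum>ys\<in>permutations_of_set (A - {x}). g (card {a\<in>A. R a x} + S x ys))"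
    unfolding sum_permutations_of_set_Cons[OF A]
    by (intro sum.cong refl) (simp add: head cnt)
  also have "\<dots> = (\<Sum>x\<in>A. mahonian_sum (card A - 1) (\<lambda>k. g (card {a\<in>A. R a x} + k)))"
    by (intro sum.cong refl tail)
  also have "\<dots> = (\<Sum>r<card A. mahonian_sum (card A - 1) (\<lambda>k. g (r + k)))"
    by (rule sum_over_ranks[OF A(1) R])
  also have "\<dots> = mahonian_sum (card A) g"
    using A by (cases "card A") auto
  finally show ?thesis .
qed

lemma inv_list_mahonian:
  "finite A \<Longrightarrow> (\<Sum>xs\<in>permutations_of_set A. g (inv_list xs)) = mahonian_sum (card A) g"
proof (induction "card A" arbitrary: A g)
  case 0
  then show ?case by simp
next
  case (Suc n)
  show ?case
  proof (rule sum_Cons_mahonian[where R = "(<)" and S = "\<lambda>_. inv_list"])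
    show "A \<noteq> {}" using Suc.hyps by auto
    show "(\<Sum>ys\<in>permutations_of_set (A - {x}). g (inv_list ys)) = mahonian_sum (card A - 1) g"
      if "x \<in> A" for x g
      using Suc.hyps(1)[of "A - {x}" g] Suc.hyps(2) Suc.prems that by simp
  qed (use Suc.prems in auto)
qed

text \<open>For adjacent letters y, z of \<open>ys\<close> with lifted values y', z', the truth
  values satisfy [m < y] + [y < z] = [y' < z'] + [m < z], whichever side of \<open>m\<close> they
  lie on. By this identity the induction moves \<open>m\<close> past one letter at a time.\<close>

lemma maj_rev_Cons:
  assumes "m \<notin> set ys" "\<forall>y\<in>set ys. y < N"
  shows "maj_rev (m # ys) =
    length (filter (\<lambda>y. y > m) ys) + maj_rev (map (\<lambda>y. if y < m then y + N else y) ys)"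
  using assms
proof (induction ys)
  case (Cons y ys)
  then show ?case by (cases ys) (auto split: if_splits)
qed simp

lemma maj_rev_mahonian:
  "finite A \<Longrightarrow> (\<Sum>xs\<in>permutations_of_set A. g (maj_rev xs)) = mahonian_sum (card A) g"
proof (induction "card A" arbitrary: A g)
  case 0
  then show ?case by simp
next
  case (Suc n)
  \<comment> \<open>A shift exceeding every letter keeps lifted letters apart from, and above, the
    others.\<close>
  define N where "N = Suc (Max A)"
  have N: "a < N" if "a \<in> A" for a
    using that Suc.prems by (simp add: N_def le_imp_less_Suc)
  define s where "s m y = (if y < m then y + N else y)" for m y
  have inj: "inj_on (s m) A" for m
    by (rule inj_onI) (auto simp: s_def dest: N split: if_splits)
  show ?case
  proof (rule sum_Cons_mahonian[where R = "(>)" and S = "\<lambda>m ys. maj_rev (map (s m) ys)"])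
    show "A \<noteq> {}" using Suc.hyps by auto
    show "(\<Sum>ys\<in>permutations_of_set (A - {m}). g (maj_rev (map (s m) ys)))
        = mahonian_sum (card A - 1) g" if "m \<in> A" for m g
    proof -
      have inj': "inj_on (s m) (A - {m})"
        using inj by (rule inj_on_subset) auto
      have "inj_on (map (s m)) (permutations_of_set (A - {m}))"
        by (rule inj_onI) (metis inj' inj_on_map_eq_map permutations_of_setD(1) sup.idem)
      then have "(\<Sum>ys\<in>permutations_of_set (A - {m}). g (maj_rev (map (s m) ys))) =
            (\<Sum>ys\<in>permutations_of_set (s m ` (A - {m})). g (maj_rev ys))"
        by (simp add: permutations_of_set_image_inj[OF inj'] sum.reindex)
      \<comment> \<open>Lifting changes the set of letters but not its size; this is why the
        induction ranges over all finite \<open>A\<close>.\<close>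
      also have "\<dots> = mahonian_sum (card (s m ` (A - {m}))) g"
        using Suc.hyps Suc.prems that by (intro Suc.hyps(1)) (simp_all add: card_image[OF inj'])
      finally show ?thesis
        using Suc.prems that by (simp add: card_image[OF inj'])
    qed
    show "maj_rev (m # ys) = length (filter (\<lambda>y. y > m) ys) + maj_rev (map (s m) ys)"
      if "ys \<in> permutations_of_set (A - {m})" for m ys
      unfolding s_def
      by (rule maj_rev_Cons) (use that N in \<open>auto simp: permutations_of_set_def\<close>)
  qed (use Suc.prems in auto)
qed

text \<open>No induction here: after the first letter is split off, the tail carries the major
  index, whose distribution is known, and reversal permutes the tails.\<close>

lemma first_plus_maj_mahonian:
  assumes "finite A" "A \<noteq> {}"
  shows "(\<Sum>xs\<in>permutations_of_set A. g (first_plus_maj xs)) = mahonian_sum (card A) g"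
proof (rule sum_Cons_mahonian[where R = "(<)" and S = "\<lambda>_ ys. maj_rev (rev ys)"])
  show "(\<Sum>ys\<in>permutations_of_set (A - {x}). g (maj_rev (rev ys))) = mahonian_sum (card A - 1) g"
    if "x \<in> A" for x g
  proof -
    have "(\<Sum>ys\<in>permutations_of_set (A - {x}). g (maj_rev (rev ys))) =
          (\<Sum>ys\<in>rev ` permutations_of_set (A - {x}). g (maj_rev ys))"
      by (subst sum.reindex) (auto simp: inj_on_def)
    also have "rev ` permutations_of_set (A - {x}) = permutations_of_set (A - {x})"
      by (rule rev_permutations_of_set)
    finally show ?thesis
      using assms that by (simp add: maj_rev_mahonian)
  qed
qed (use assms in auto)

section \<open>Words of permutations\<close>

lemma bij_betw_word:
  "bij_betw (\<lambda>\<pi>. map \<pi> [1..<Suc n]) {\<pi>. \<pi> permutes {1..n}} (permutations_of_set {1..n})"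
proof -
  let ?w = "\<lambda>\<pi>. map \<pi> [1..<Suc n]"
  have inj: "inj_on ?w {\<pi>. \<pi> permutes {1..n}}"
  proof (rule inj_onI)
    fix \<pi> \<sigma> assume *: "\<pi> \<in> {\<pi>. \<pi> permutes {1..n}}" "\<sigma> \<in> {\<pi>. \<pi> permutes {1..n}}" "?w \<pi> = ?w \<sigma>"
    show "\<pi> = \<sigma>"
    proof
      fix x
      show "\<pi> x = \<sigma> x"
      proof (cases "x \<in> {1..n}")
        case True
        then have "x \<in> set [1..<Suc n]" by auto
        then show ?thesis using *(3) by (meson map_eq_conv)
      qed (use * in \<open>simp add: permutes_not_in\<close>)
    qed
  qed
  have sub: "?w ` {\<pi>. \<pi> permutes {1..n}} \<subseteq> permutations_of_set {1..n}"
  proof safe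
    fix \<pi> assume \<pi>: "\<pi> permutes {1..n}"
    have "set [1..<Suc n] = {1..n}" by auto
    then show "?w \<pi> \<in> permutations_of_set {1..n}"
      by (intro permutations_of_setI)
         (simp_all only: set_map permutes_image[OF \<pi>] distinct_map distinct_upt
            permutes_inj_on[OF \<pi>] simp_thms)
  qed
  \<comment> \<open>Surjectivity by counting: both sides have n! elements.\<close>
  have "?w ` {\<pi>. \<pi> permutes {1..n}} = permutations_of_set {1..n}"
    by (rule card_subset_eq[OF _ sub])
       (simp_all only: card_image[OF inj] card_permutations[OF refl finite_atLeastAtMost]
          card_permutations_of_set finite_permutations_of_set finite_atLeastAtMost)
  with inj show ?thesis by (simp add: bij_betw_def)
qed

lemma length_filter_map_upt:
  "length (filter P (map f [a..<b])) = card {j\<in>{a..<b}. P (f j)}"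
proof -
  have "length (filter P (map f [a..<b])) = length (filter (P \<circ> f) [a..<b])"
    by (simp add: filter_map)
  also have "\<dots> = card (set (filter (P \<circ> f) [a..<b]))"
    by (rule distinct_card[symmetric]) simp
  finally show ?thesis by simp
qed

lemma inv_list_map_upt:
  assumes "a \<le> b"
  shows "inv_list (map f [a..<b]) = card {(i, j). a \<le> i \<and> i < j \<and> j < b \<and> f i > f j}"
  using assms
proof (induction rule: inc_induct)
  case base
  have "{(i, j). b \<le> i \<and> i < j \<and> j < b \<and> f i > f j} = {}" by auto
  then show ?case by (simp only: upt_conv_Nil order_refl list.map inv_list.simps card.empty)
next
  case (step a)
  define I where "I a = {(i, j). a \<le> i \<and> i < j \<and> j < b \<and> f i > f j}" for a
  define J where "J = {j \<in> {Suc a..<b}. f j < f a}"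
  have fin: "finite (I (Suc a))"
    by (rule finite_subset[of _ "{..<b} \<times> {..<b}"]) (auto simp: I_def)
  \<comment> \<open>Inversions split by whether their left position is \<open>a\<close>.\<close>
  have "I a = Pair a ` J \<union> I (Suc a)"
    by (auto simp: I_def J_def Suc_le_eq le_less)
  then have "card (I a) = card (Pair a ` J \<union> I (Suc a))" by simp
  also have "\<dots> = card (Pair a ` J) + card (I (Suc a))"
    by (rule card_Un_disjoint) (use fin in \<open>auto simp: I_def J_def\<close>)
  also have "card (Pair a ` J) = card J"
    by (rule card_image) (simp add: inj_on_def)
  finally have "card (I a) = card J + card (I (Suc a))" .
  moreover have "inv_list (map f [a..<b]) = card J + inv_list (map f [Suc a..<b])"
    unfolding upt_conv_Cons[OF step.hyps(2)] list.map inv_list.simps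
    by (simp only: length_filter_map_upt J_def)
  ultimately show ?case
    using step.IH by (simp only: I_def)
qed

lemma inv_stat_eq_inv_list: "inv_stat n \<pi> = inv_list (map \<pi> [1..<Suc n])"
  by (subst inv_list_map_upt) (auto simp: inv_stat_def less_Suc_eq_le)

text \<open>The weight \<open>Suc j - a\<close> is the position of the descent, counted from 1
  within the word. Induction on \<open>b\<close>, since the letter appended last heads the reversed
  word.\<close>

lemma maj_rev_rev_map_upt:
  "maj_rev (rev (map f [a..<b])) = (\<Sum>j | a \<le> j \<and> Suc j < b \<and> f (Suc j) < f j. Suc j - a)"
proof (induction b)
  case (Suc b)
  let ?D = "\<lambda>b. {j. a \<le> j \<and> Suc j < b \<and> f (Suc j) < f j}"
  have fin: "finite (?D b)" for b
    by (rule finite_subset[of _ "{..<b}"]) auto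
  show ?case
  proof (cases "a < b")
    case True
    then obtain c where c: "b = Suc c" "a \<le> c" by (cases b) auto
    have "?D (Suc b) = (if f b < f c then insert c (?D b) else ?D b)"
      using c by (auto simp: less_Suc_eq)
    then have "(\<Sum>j\<in>?D (Suc b). Suc j - a) =
        (if f b < f c then Suc c - a else 0) + (\<Sum>j\<in>?D b. Suc j - a)"
      using fin[of b] c by auto
    then show ?thesis using Suc.IH c by (simp add: Suc_diff_le)
  next
    case False
    then have "?D (Suc b) = {}" by auto
    then show ?thesis using False by (simp only:) (auto simp: le_less)
  qed
qed simp

section \<open>Vincular patterns\<close>

text \<open>The last two letters are adjacent, so the first two positions determine an
  occurrence.\<close>

lemma occurrences_x_yz:
  assumes "letters p = [x, y, z]" "dashes p = {1}" "\<not> left_bracket p" "\<not> right_bracket p"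
  shows "occurrences p n \<pi> = card {(i, j). 1 \<le> i \<and> i < j \<and> j < n \<and>
     (\<pi> i < \<pi> j \<longleftrightarrow> x < y) \<and> (\<pi> j < \<pi> i \<longleftrightarrow> y < x) \<and>
     (\<pi> i < \<pi> (j + 1) \<longleftrightarrow> x < z) \<and> (\<pi> (j + 1) < \<pi> i \<longleftrightarrow> z < x) \<and>
     (\<pi> j < \<pi> (j + 1) \<longleftrightarrow> y < z) \<and> (\<pi> (j + 1) < \<pi> j \<longleftrightarrow> z < y)}"
    (is "_ = card ?S")
proof -
  define S where "S = ?S"
  have mem: "occurrence p n \<pi> [i, j, k] \<longleftrightarrow> (i, j) \<in> S \<and> k = j + 1" for i j k
  proof -
    have "(\<forall>r. Suc r < length [i, j, k] \<and> Suc r \<notin> dashes p \<longrightarrow>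
        [i, j, k] ! Suc r = [i, j, k] ! r + 1) \<longleftrightarrow> k = j + 1"
      using assms(2) by (auto simp: less_Suc_eq all_conj_distrib nth_Cons')
    then show ?thesis
      unfolding occurrence_def assms(1) S_def
      using assms(3,4) by (auto simp: numeral_3_eq_3 All_less_Suc2)
  qed
  have "{xs. occurrence p n \<pi> xs} = (\<lambda>(i, j). [i, j, j + 1]) ` S"
  proof (intro equalityI subsetI)
    fix xs assume xs: "xs \<in> {xs. occurrence p n \<pi> xs}"
    then have "length xs = Suc (Suc (Suc 0))"
      using assms(1) by (simp add: occurrence_def)
    then obtain i j k where "xs = [i, j, k]"
      by (auto simp: length_Suc_conv)
    with xs mem show "xs \<in> (\<lambda>(i, j). [i, j, j + 1]) ` S"
      by (force simp: image_iff)
  qed (use mem in auto)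
  moreover have "inj_on (\<lambda>(i, j). [i, j, j + 1]) S"
    by (auto simp: inj_on_def)
  ultimately show ?thesis
    by (simp only: occurrences_def card_image S_def)
qed

lemma occurrences_a_cb:
  "occurrences pat_a_cb n \<pi> =
     card {(i, j). 1 \<le> i \<and> i < j \<and> j < n \<and> \<pi> i < \<pi> (j + 1) \<and> \<pi> (j + 1) < \<pi> j}"
  by (subst occurrences_x_yz[of _ 1 3 2])
     (auto simp: pat_a_cb_def intro!: arg_cong[where f = card])

lemma occurrences_c_ba:
  "occurrences pat_c_ba n \<pi> =
     card {(i, j). 1 \<le> i \<and> i < j \<and> j < n \<and> \<pi> (j + 1) < \<pi> j \<and> \<pi> j < \<pi> i}"
  by (subst occurrences_x_yz[of _ 3 2 1])
     (auto simp: pat_c_ba_def intro!: arg_cong[where f = card])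

text \<open>For a descent at \<open>j\<close> and any earlier \<open>i\<close>, injectivity puts
  \<open>\<pi> i\<close> below, between or above the two descent values, so exactly one pattern
  occurs.\<close>

lemma occurrences_length_3:
  assumes "inj \<pi>"
  shows "occurrences pat_a_cb n \<pi> + occurrences pat_b_ca n \<pi> + occurrences pat_c_ba n \<pi> =
    (\<Sum>j | 2 \<le> j \<and> j < n \<and> \<pi> (Suc j) < \<pi> j. j - 1)"
proof -
  let ?A = "{(i, j). 1 \<le> i \<and> i < j \<and> j < n \<and> \<pi> i < \<pi> (j + 1) \<and> \<pi> (j + 1) < \<pi> j}"
  let ?B = "{(i, j). 1 \<le> i \<and> i < j \<and> j < n \<and> \<pi> (j + 1) < \<pi> i \<and> \<pi> i < \<pi> j}"
  let ?C = "{(i, j). 1 \<le> i \<and> i < j \<and> j < n \<and> \<pi> (j + 1) < \<pi> j \<and> \<pi> j < \<pi> i}"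
  let ?D = "{j. 2 \<le> j \<and> j < n \<and> \<pi> (Suc j) < \<pi> j}"
  have fin: "finite X" if "X \<subseteq> {..<n} \<times> {..<n}" for X
    using that by (rule finite_subset) simp
  have ne: "\<pi> i < \<pi> j \<or> \<pi> j < \<pi> i" if "i \<noteq> j" for i j
    using injD[OF assms, of i j] that by linarith
  have "card ?A + card ?B + card ?C = card (?A \<union> ?B) + card ?C"
    by (subst card_Un_disjoint) (auto intro!: fin)
  also have "\<dots> = card (?A \<union> ?B \<union> ?C)"
    by (subst (2) card_Un_disjoint) (auto intro!: fin)
  also have "?A \<union> ?B \<union> ?C = (\<lambda>(j, i). (i, j)) ` (SIGMA j:?D. {1..<j})"
    (is "?L = ?R")
  proof
    show "?L \<subseteq> ?R" by (auto simp: image_iff)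
    show "?R \<subseteq> ?L"
    proof
      fix x assume "x \<in> ?R"
      then obtain i j where x: "x = (i, j)" "j \<in> ?D" "i \<in> {1..<j}" by auto
      then show "x \<in> ?L"
        using ne[of i j] ne[of i "Suc j"] by auto
    qed
  qed
  also have "card \<dots> = card (SIGMA j:?D. {1..<j})"
    by (rule card_image) (auto simp: inj_on_def)
  also have "\<dots> = (\<Sum>j\<in>?D. j - 1)"
    by simp
  finally show ?thesis
    by (simp only: occurrences_a_cb occurrences_b_ca occurrences_c_ba)
qed

lemma vinc_stat_eq_first_plus_maj:
  assumes "n \<ge> 1" "inj \<pi>"
  shows "vinc_stat n \<pi> = first_plus_maj (map \<pi> [1..<Suc n])"
proof -
  have upt: "[1..<Suc n] = 1 # [2..<Suc n]"
    using assms(1) by (simp add: upt_conv_Cons numeral_2_eq_2 del: upt_Suc)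
  have "first_plus_maj (map \<pi> [1..<Suc n]) =
      length (filter (\<lambda>y. y < \<pi> 1) (map \<pi> [2..<Suc n])) + maj_rev (rev (map \<pi> [2..<Suc n]))"
    unfolding upt by (simp del: upt_Suc)
  also have "length (filter (\<lambda>y. y < \<pi> 1) (map \<pi> [2..<Suc n])) = occurrences pat_lb_a n \<pi>"
    unfolding length_filter_map_upt occurrences_lb_a
    by (rule arg_cong[where f = card]) auto
  \<comment> \<open>The tail starts at index 2, so its weight \<open>Suc j - 2\<close> is
    \<open>j - 1\<close>, the number of positions before \<open>j\<close>.\<close>
  also have "maj_rev (rev (map \<pi> [2..<Suc n])) =
      (\<Sum>j | 2 \<le> j \<and> j < n \<and> \<pi> (Suc j) < \<pi> j. j - 1)"
    unfolding maj_rev_rev_map_upt by simp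
  finally show ?thesis
    using occurrences_length_3[OF assms(2), of n] by (simp add: vinc_stat_def)
qed

theorem theorem2:
  fixes n :: nat and k :: int
  assumes "n \<ge> 1"
  shows "card {\<pi>. \<pi> permutes {1..n} \<and> int (vinc_stat n \<pi>) = k}
       = card {\<pi>. \<pi> permutes {1..n} \<and> int (inv_stat n \<pi>) = k}"
proof -
  let ?P = "{\<pi>. \<pi> permutes {1..n}}" and ?W = "permutations_of_set {1..n}"
  \<comment> \<open>With this indicator, summing \<open>g\<close> over the values of a statistic
    counts those equal to \<open>k\<close>.\<close>
  define g :: "nat \<Rightarrow> nat" where "g v = of_bool (int v = k)" for v
  have card_eq: "card {\<pi>. \<pi> permutes {1..n} \<and> int (F \<pi>) = k} = (\<Sum>xs\<in>?W. g (G xs))"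
    if "\<And>\<pi>. \<pi> permutes {1..n} \<Longrightarrow> F \<pi> = G (map \<pi> [1..<Suc n])" for F G
  proof -
    have "card {\<pi>. \<pi> permutes {1..n} \<and> int (F \<pi>) = k} = (\<Sum>\<pi>\<in>?P. g (F \<pi>))"
      by (simp add: g_def finite_permutations Int_def)
    also have "\<dots> = (\<Sum>\<pi>\<in>?P. g (G (map \<pi> [1..<Suc n])))"
      by (intro sum.cong refl) (simp add: that del: upt_Suc)
    also have "\<dots> = (\<Sum>xs\<in>?W. g (G xs))"
      by (rule sum.reindex_bij_betw[OF bij_betw_word])
    finally show ?thesis .
  qed
  have "card {\<pi>. \<pi> permutes {1..n} \<and> int (vinc_stat n \<pi>) = k} = (\<Sum>xs\<in>?W. g (first_plus_maj xs))"
    by (rule card_eq) (rule vinc_stat_eq_first_plus_maj[OF assms permutes_inj])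
  also have "\<dots> = mahonian_sum (card {1..n}) g"
    by (rule first_plus_maj_mahonian) (use assms in auto)
  also have "\<dots> = (\<Sum>xs\<in>?W. g (inv_list xs))"
    by (simp add: inv_list_mahonian)
  also have "\<dots> = card {\<pi>. \<pi> permutes {1..n} \<and> int (inv_stat n \<pi>) = k}"
    by (rule card_eq[symmetric]) (rule inv_stat_eq_inv_list)
  finally show ?thesis .
qed

end
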